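(* Let $\mathcal{L}$ be a finite meet-distributive meet-semilattice and $\Gamma_{\mathcal{L}}$ its Alexander dual. Let $h(\Gamma_{\mathcal{L}})=(h_0,h_1,\ldots)$ be the $h$-vector of $\Gamma_{\mathcal{L}}$. Then, for all $i$, one has $$h_i=|\{\alpha\in\mathcal{L} : |N(\alpha)|=i\}|.$$
   Context: Let $\mathcal{L}$ be a finite meet-semilattice with unique minimal element $\hat 0$. An element $\beta$ is a lower neighbor of $\alpha$ (i.e. $\alpha$ covers $\beta$) if $\beta<\alpha$ and there is no $\gamma$ with $\beta<\gamma<\alpha$; $N(\alpha)$ is the set of lower neighbors of $\alpha$. A join-irreducible element of $\mathcal{L}$ is one that covers exactly one element of $\mathcal{L}$ (so $\hat 0$ is not join-irreducible). $P\subset\mathcal{L}$ is the set of join-irreducible elements, and $\ell(\alpha)=\{p\in P : p\le\alpha\}$ for $\alpha\in\mathcal{L}$. $\mathcal{L}$ is called meet-distributive if every interval $[\alpha,\beta]=\{\gamma\in\mathcal{L}:\alpha\le\gamma\le\beta\}$ such that $\alpha$ is the meet of the lower neighbors of $\beta$ in $[\alpha,\beta]$ is a boolean lattice. The Alexander dual $\Gamma_{\mathcal{L}}$ of $\mathcal{L}$ is the simplicial complex on the $2|P|$ vertices $\{x_p,y_p\}_{p\in P}$ whose facets are the sets $F_\alpha=\{x_q : q\in P\setminus\ell(\alpha)\}\cup\{y_q : q\in\ell(\alpha)\}$, $\alpha\in\mathcal{L}$. (It is the Alexander dual of the simplicial complex whose Stanley–Reisner ideal is generated by the monomials $\prod_{p\in\ell(\alpha)}x_p\prod_{p\in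 P\setminus\ell(\alpha)}y_p$, $\alpha\in\mathcal{L}$.) It is pure of dimension $|P|-1$. The $h$-vector of a $(d-1)$-dimensional simplicial complex with $f_j$ faces of cardinality $j+1$ ($f_{-1}=1$) is defined by $\sum_i h_i\lambda^i=\sum_{i=0}^d f_{i-1}\lambda^i(1-\lambda)^{d-i}$; equivalently $f_j=\sum_{i=0}^{j+1}\binom{d-i}{d-j-1}h_i$. Set $h_i=0$ for $i>d$. *)

theory Defs
  imports Main "HOL-Computational_Algebra.Polynomial"
begin

definition lower_neighbors :: "'a::order \<Rightarrow> 'a set" where
  "lower_neighbors \<alpha> = {\<beta>. \<beta> < \<alpha> \<and> \<not> (\<exists>\<gamma>. \<beta> < \<gamma> \<and> \<gamma> < \<alpha>)}"

definition join_irreducibles :: "'a::order set" where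
  "join_irreducibles = {\<alpha>. \<exists>!\<beta>. \<beta> \<in> lower_neighbors \<alpha>}"

definition irreducibles_below :: "'a::order \<Rightarrow> 'a set" where
  "irreducibles_below \<alpha> = {p \<in> join_irreducibles. p \<le> \<alpha>}"

(* A finite boolean lattice is a poset isomorphic to the lattice of subsets of an n-element set,
   for some n \<ge> 0; the set I carries the induced order. *)
definition boolean_lattice_on :: "'a::order set \<Rightarrow> bool" where
  "boolean_lattice_on I \<longleftrightarrow>
     (\<exists>(n::nat) f. bij_betw f I (Pow {..<n}) \<and> (\<forall>x\<in>I. \<forall>y\<in>I. x \<le> y \<longleftrightarrow> f x \<subseteq> f y))"

(* Intervals with \<alpha> = \<beta> are left out: there the meet would be the empty one, for which
   Inf_fin is unspecified, and the one-element interval is boolean anyway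
   (boolean_lattice_on_singleton). If \<alpha> < \<beta>, the set of lower neighbors of \<beta>
   in the interval is nonempty (lower_neighbors_interval_nonempty). *)
definition meet_distributive :: "'a::{finite, semilattice_inf} itself \<Rightarrow> bool" where
  "meet_distributive _ \<longleftrightarrow>
     (\<forall>\<alpha> \<beta> :: 'a. \<alpha> < \<beta> \<and> \<alpha> = Inf_fin (lower_neighbors \<beta> \<inter> {\<alpha>..\<beta>})
        \<longrightarrow> boolean_lattice_on {\<alpha>..\<beta>})"

lemma boolean_lattice_on_singleton: "boolean_lattice_on {\<alpha>..\<alpha>}"
  unfolding boolean_lattice_on_def
  by (rule exI[of _ 0], rule exI[of _ "\<lambda>_. {}"]) (simp add: bij_betw_def)

lemma lower_neighbors_interval_nonempty:
  fixes \<alpha> \<beta> :: "'a::{finite, order}"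
  assumes "\<alpha> < \<beta>"
  shows "lower_neighbors \<beta> \<inter> {\<alpha>..\<beta>} \<noteq> {}"
proof -
  have "finite {\<alpha>..<\<beta>}" "{\<alpha>..<\<beta>} \<noteq> {}"
    using assms by auto
  then obtain \<gamma> where "\<gamma> \<in> {\<alpha>..<\<beta>}" "\<forall>\<delta>\<in>{\<alpha>..<\<beta>}. \<gamma> \<le> \<delta> \<longrightarrow> \<gamma> = \<delta>"
    by (meson finite_has_maximal)
  then have "\<gamma> \<in> lower_neighbors \<beta> \<inter> {\<alpha>..\<beta>}"
    by (auto simp: lower_neighbors_def less_le_not_le)
  then show ?thesis by blast
qed

datatype 'a vertex = X 'a | Y 'a

definition dual_facet :: "'a::order \<Rightarrow> 'a vertex set" where
  "dual_facet \<alpha> = X ` (join_irreducibles - irreducibles_below \<alpha>) \<union> Y ` irreducibles_below \<alpha>"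

(* A simplicial complex is given as the set of its faces, the empty face included. The sets
   dual_facet \<alpha> all have the cardinality of join_irreducibles and are pairwise distinct, so
   they are exactly the facets. *)
definition alexander_dual :: "'a::{finite, semilattice_inf} vertex set set" where
  "alexander_dual = {F. \<exists>\<alpha>. F \<subseteq> dual_facet \<alpha>}"

(* Indexed by cardinality: the entry at k is f_(k-1). *)
definition face_count :: "'v set set \<Rightarrow> nat \<Rightarrow> nat" where
  "face_count \<Delta> k = card {F \<in> \<Delta>. card F = k}"

(* The dimension plus one, i.e. the number d in the definition of the h-vector. *)
definition complex_rank :: "'v set set \<Rightarrow> nat" where
  "complex_rank \<Delta> = Max (card ` \<Delta>)"

definition h_polynomial :: "'v set set \<Rightarrow> int poly" where
  "h_polynomial \<Delta> =
     (\<Sum>i = 0..complex_rank \<Delta>.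
        of_nat (face_count \<Delta> i) * monom 1 i * (1 - monom 1 1) ^ (complex_rank \<Delta> - i))"

definition h_vector :: "'v set set \<Rightarrow> nat \<Rightarrow> int" where
  "h_vector \<Delta> i = coeff (h_polynomial \<Delta>) i"

end

theory Submission
  imports Defs
begin

text \<open>
  In a meet-distributive semilattice, passing from \<alpha> to a lower neighbor \<beta> removes exactly one
  join-irreducible element. Indeed, if \<open>p < \<alpha>\<close> is removed, then \<open>p \<le> \<beta>'\<close> for another lower neighbor
  \<open>\<beta>'\<close>, and p is removed in passing from \<open>\<beta>'\<close> to its lower neighbor \<open>inf \<beta> \<beta>'\<close>; by induction it is
  determined by \<open>\<beta>'\<close>. It does not depend on \<open>\<beta>'\<close>, since \<open>inf \<beta>' \<beta>''\<close> is not below \<beta> and so some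
  join-irreducible element below both \<open>\<beta>'\<close> and \<open>\<beta>''\<close> is removed.

  Hence the set R of the vertices \<open>Y p\<close>, p removable from \<alpha>, has as many elements as \<alpha> has lower
  neighbors. The intervals from R to the facet of \<alpha> partition the complex: a face whose
  Y-vertices are those of B lies in the interval of the least \<alpha> with \<open>B \<subseteq> irreducibles_below \<alpha>\<close>.
  In the h-polynomial such an interval contributes the monomial whose exponent is \<open>card R\<close>.
\<close>

section \<open>Lower neighbors and join-irreducible elements\<close>

lemma le_lower_neighbor:
  fixes \<alpha> \<beta> :: "'a::{finite, order}"
  assumes "\<alpha> < \<beta>"
  obtains \<gamma> where "\<gamma> \<in> lower_neighbors \<beta>" "\<alpha> \<le> \<gamma>"
  using lower_neighbors_interval_nonempty[OF assms] by auto

lemma inf_eq_lower_neighbor: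
  fixes \<alpha> \<beta> \<gamma> :: "'a::semilattice_inf"
  assumes "\<beta> \<in> lower_neighbors \<alpha>" "\<beta> \<le> \<gamma>" "\<not> \<alpha> \<le> \<gamma>"
  shows "inf \<alpha> \<gamma> = \<beta>"
proof -
  have "\<beta> \<le> inf \<alpha> \<gamma>" "inf \<alpha> \<gamma> < \<alpha>"
    using assms by (auto simp: lower_neighbors_def less_le_not_le)
  then show ?thesis
    using assms(1) by (auto simp: lower_neighbors_def le_less)
qed

lemma lower_neighbors_incomparable:
  assumes "\<beta> \<in> lower_neighbors \<alpha>" "\<gamma> \<in> lower_neighbors \<alpha>" "\<beta> \<le> \<gamma>"
  shows "\<beta> = \<gamma>"
  using assms unfolding lower_neighbors_def by (auto simp: le_less)

text \<open>In a minimal failure of the forward direction every element strictly below \<alpha> is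
  below \<gamma>. All lower neighbors of \<alpha> then coincide with
  \<open>inf \<alpha> \<gamma>\<close>, so \<alpha> is itself join-irreducible and hence below
  \<gamma>. The equivalence lets elements be compared through their sets of join-irreducible
  elements.\<close>

lemma irreducibles_below_subset_iff:
  fixes \<alpha> \<gamma> :: "'a::{finite, semilattice_inf}"
  shows "irreducibles_below \<alpha> \<subseteq> irreducibles_below \<gamma> \<longleftrightarrow> \<alpha> \<le> \<gamma>"
proof
  assume "irreducibles_below \<alpha> \<subseteq> irreducibles_below \<gamma>"
  then show "\<alpha> \<le> \<gamma>"
  proof (induction "card {..\<alpha>}" arbitrary: \<alpha> rule: less_induct)
    case less
    show ?case
    proof (rule ccontr)
      assume nle: "\<not> \<alpha> \<le> \<gamma>"
      have below: "\<beta> \<le> \<gamma>" if "\<beta> < \<alpha>" for \<beta>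
      proof (rule less.hyps)
        show "card {..\<beta>} < card {..\<alpha>}"
          using that by (intro psubset_card_mono) auto
        show "irreducibles_below \<beta> \<subseteq> irreducibles_below \<gamma>"
          using less.prems that by (fastforce simp: irreducibles_below_def)
      qed
      have "inf \<alpha> \<gamma> < \<alpha>"
        using nle by (simp add: less_le_not_le)
      then obtain \<beta> where \<beta>: "\<beta> \<in> lower_neighbors \<alpha>" by (rule le_lower_neighbor)
      have "inf \<alpha> \<gamma> = \<delta>" if "\<delta> \<in> lower_neighbors \<alpha>" for \<delta>
        using that below nle by (intro inf_eq_lower_neighbor) (auto simp: lower_neighbors_def)
      then have "\<alpha> \<in> join_irreducibles"
        using \<beta> unfolding join_irreducibles_def by blast
      then have "\<alpha> \<in> irreducibles_below \<gamma>"
        using less.prems by (auto simp: irreducibles_below_def)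
      then show False
        using nle by (simp add: irreducibles_below_def)
    qed
  qed
qed (auto simp: irreducibles_below_def)

section \<open>Boolean intervals spanned by lower neighbors\<close>

lemma meet_distributive_boolean:
  fixes \<alpha> :: "'a::{finite, semilattice_inf}"
  assumes "meet_distributive TYPE('a)" "lower_neighbors \<alpha> \<noteq> {}"
  obtains \<mu> where "lower_neighbors \<alpha> \<subseteq> {\<mu>..\<alpha>}" "boolean_lattice_on {\<mu>..\<alpha>}"
proof
  \<comment> \<open>All lower neighbors of \<alpha> lie above their meet, so restricting them to the
    interval, as in \<open>meet_distributive\<close>, loses none of them.\<close>
  let ?\<mu> = "Inf_fin (lower_neighbors \<alpha>)"
  obtain \<beta> where \<beta>: "\<beta> \<in> lower_neighbors \<alpha>" using assms(2) by blast
  show sub: "lower_neighbors \<alpha> \<subseteq> {?\<mu>..\<alpha>}"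
  proof
    fix \<gamma> assume \<gamma>: "\<gamma> \<in> lower_neighbors \<alpha>"
    then have "?\<mu> \<le> \<gamma>" by (intro Inf_fin.coboundedI) auto
    with \<gamma> show "\<gamma> \<in> {?\<mu>..\<alpha>}" by (auto simp: lower_neighbors_def)
  qed
  have "?\<mu> < \<alpha>"
    using \<beta> sub le_less_trans[of ?\<mu> \<beta> \<alpha>] by (auto simp: lower_neighbors_def)
  moreover have "lower_neighbors \<alpha> \<inter> {?\<mu>..\<alpha>} = lower_neighbors \<alpha>"
    using sub by blast
  ultimately show "boolean_lattice_on {?\<mu>..\<alpha>}"
    using assms(1) unfolding meet_distributive_def by simp
qed

text \<open>An order isomorphism onto a powerset turns meets into intersections and lower neighbors
  of the top into coatoms. This reduces questions about lower neighbors of \<alpha> to deleting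
  single points from the set \<open>f \<alpha>\<close>.\<close>

lemma boolean_lattice_on_iso:
  fixes \<mu> \<alpha> :: "'a::semilattice_inf"
  assumes "boolean_lattice_on {\<mu>..\<alpha>}" "\<mu> \<le> \<alpha>"
  obtains f :: "'a \<Rightarrow> nat set" where
    "\<forall>x\<in>{\<mu>..\<alpha>}. \<forall>y\<in>{\<mu>..\<alpha>}. x \<le> y \<longleftrightarrow> f x \<subseteq> f y"
    "\<forall>x\<in>{\<mu>..\<alpha>}. f x \<subseteq> f \<alpha>"
    "\<forall>x\<in>{\<mu>..\<alpha>}. \<forall>y\<in>{\<mu>..\<alpha>}. f (inf x y) = f x \<inter> f y"
    "\<forall>\<beta>\<in>lower_neighbors \<alpha>. \<mu> \<le> \<beta> \<longrightarrow> (\<exists>i\<in>f \<alpha>. f \<beta> = f \<alpha> - {i})"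
proof -
  obtain n :: nat and f where f: "bij_betw f {\<mu>..\<alpha>} (Pow {..<n})"
    and le: "\<And>x y. x \<in> {\<mu>..\<alpha>} \<Longrightarrow> y \<in> {\<mu>..\<alpha>} \<Longrightarrow> x \<le> y \<longleftrightarrow> f x \<subseteq> f y"
    using assms(1) unfolding boolean_lattice_on_def by blast
  have im: "f ` {\<mu>..\<alpha>} = Pow {..<n}"
    using f by (simp add: bij_betw_def)
  have fle: "f x \<subseteq> f \<alpha>" if "x \<in> {\<mu>..\<alpha>}" for x
    using le[OF that, of \<alpha>] that assms(2) by simp
  have surj: "\<exists>x\<in>{\<mu>..\<alpha>}. f x = A" if "A \<subseteq> f \<alpha>" for A
  proof -
    have "f \<alpha> \<subseteq> {..<n}" using im assms(2) by auto
    then have "A \<in> f ` {\<mu>..\<alpha>}" using that im by blast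
    then show ?thesis by blast
  qed
  have inf: "f (inf x y) = f x \<inter> f y" if x: "x \<in> {\<mu>..\<alpha>}" and y: "y \<in> {\<mu>..\<alpha>}" for x y
  proof
    have xy: "inf x y \<in> {\<mu>..\<alpha>}" using x y by (auto intro: le_infI1)
    then show "f (inf x y) \<subseteq> f x \<inter> f y"
      using le[OF xy x] le[OF xy y] by simp
    \<comment> \<open>The preimage of the intersection is a lower bound of x and y, hence below
      their meet.\<close>
    obtain z where z: "z \<in> {\<mu>..\<alpha>}" "f z = f x \<inter> f y"
      using surj[of "f x \<inter> f y"] fle[OF x] by blast
    have "z \<le> inf x y" using le[OF z(1) x] le[OF z(1) y] z(2) by simp
    then show "f x \<inter> f y \<subseteq> f (inf x y)" using le[OF z(1) xy] z(2) by simp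
  qed
  have "\<exists>i\<in>f \<alpha>. f \<beta> = f \<alpha> - {i}" if \<beta>: "\<beta> \<in> lower_neighbors \<alpha>" "\<mu> \<le> \<beta>" for \<beta>
  proof -
    have \<beta>lt: "\<beta> < \<alpha>" using \<beta>(1) by (simp add: lower_neighbors_def)
    then have mem: "\<beta> \<in> {\<mu>..\<alpha>}" "\<alpha> \<in> {\<mu>..\<alpha>}"
      using \<beta>(2) by auto
    have "\<not> f \<alpha> \<subseteq> f \<beta>" using le[OF mem(2,1)] \<beta>lt by auto
    then obtain i where i: "i \<in> f \<alpha>" "i \<notin> f \<beta>" by blast
    \<comment> \<open>The preimage of the coatom that omits i lies above \<beta> and is not
      \<alpha>, so it must be \<beta>.\<close>
    obtain x where x: "x \<in> {\<mu>..\<alpha>}" "f x = f \<alpha> - {i}" using surj[of "f \<alpha> - {i}"] by blast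
    have "\<beta> \<le> x" using le[OF mem(1) x(1)] x(2) i fle[OF mem(1)] by blast
    moreover have "x \<noteq> \<alpha>" using x i by auto
    ultimately have "x = \<beta>"
      using x(1) \<beta>(1) by (auto simp: lower_neighbors_def le_less)
    with i x show ?thesis by blast
  qed
  with le fle inf show thesis by (intro that[of f]) simp_all
qed

text \<open>In the powerset, \<beta> is the complement of one point i. Intersecting with it removes
  at most i from \<open>f \<gamma>\<close>, which leaves no room strictly between.\<close>

lemma inf_lower_neighbor:
  fixes \<alpha> \<beta> \<gamma> :: "'a::{finite, semilattice_inf}"
  assumes md: "meet_distributive TYPE('a)"
    and \<beta>: "\<beta> \<in> lower_neighbors \<alpha>" and \<gamma>: "\<gamma> \<in> lower_neighbors \<alpha>" and "\<beta> \<noteq> \<gamma>"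
  shows "inf \<beta> \<gamma> \<in> lower_neighbors \<gamma>"
proof -
  obtain \<mu> where sub: "lower_neighbors \<alpha> \<subseteq> {\<mu>..\<alpha>}" and bl: "boolean_lattice_on {\<mu>..\<alpha>}"
    using meet_distributive_boolean[OF md, of \<alpha>] \<beta> by blast
  have mem: "\<beta> \<in> {\<mu>..\<alpha>}" "\<gamma> \<in> {\<mu>..\<alpha>}" using sub \<beta> \<gamma> by auto
  then have "\<mu> \<le> \<alpha>" by auto
  with bl obtain f :: "'a \<Rightarrow> nat set" where
    f: "\<forall>x\<in>{\<mu>..\<alpha>}. \<forall>y\<in>{\<mu>..\<alpha>}. x \<le> y \<longleftrightarrow> f x \<subseteq> f y"
      "\<forall>x\<in>{\<mu>..\<alpha>}. f x \<subseteq> f \<alpha>"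
      "\<forall>x\<in>{\<mu>..\<alpha>}. \<forall>y\<in>{\<mu>..\<alpha>}. f (inf x y) = f x \<inter> f y"
      "\<forall>\<beta>\<in>lower_neighbors \<alpha>. \<mu> \<le> \<beta> \<longrightarrow> (\<exists>i\<in>f \<alpha>. f \<beta> = f \<alpha> - {i})"
    by (rule boolean_lattice_on_iso)
  note le = f(1)[rule_format] and top = f(2)[rule_format]
    and inf = f(3)[rule_format] and coatom = f(4)[rule_format]
  obtain i where i: "i \<in> f \<alpha>" "f \<beta> = f \<alpha> - {i}"
    using coatom[OF \<beta>] mem by auto
  have "\<not> \<gamma> \<le> \<beta>" using lower_neighbors_incomparable[OF \<gamma> \<beta>] \<open>\<beta> \<noteq> \<gamma>\<close> by blast
  then have lt: "inf \<beta> \<gamma> < \<gamma>" by (simp add: less_le_not_le)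
  have no: False if "inf \<beta> \<gamma> < \<delta>" "\<delta> < \<gamma>" for \<delta>
  proof -
    have bg: "inf \<beta> \<gamma> \<in> {\<mu>..\<alpha>}" using mem by (auto intro: le_infI1)
    then have "\<mu> \<le> \<delta>" using that(1) by (meson atLeastAtMost_iff less_imp_le order_trans)
    then have \<delta>: "\<delta> \<in> {\<mu>..\<alpha>}" using that(2) mem by auto
    have 1: "f \<delta> \<subseteq> f \<gamma>" "\<not> f \<gamma> \<subseteq> f \<delta>" "f \<beta> \<inter> f \<gamma> \<subseteq> f \<delta>" "\<not> f \<delta> \<subseteq> f \<beta> \<inter> f \<gamma>"
      using that le[OF \<delta> mem(2)] le[OF mem(2) \<delta>] le[OF bg \<delta>] le[OF \<delta> bg] inf[OF mem]
      by (auto simp: less_le_not_le)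
    then show False using i top[OF mem(2)] by blast
  qed
  show ?thesis using lt no by (auto simp: lower_neighbors_def)
qed

text \<open>The three elements are complements of points i, j, k with i different from j and k. So i
  lies in the intersection belonging to \<gamma> and \<delta>, but not in \<open>f \<beta>\<close>.
  The case \<gamma> = \<delta> is included.\<close>

lemma inf_lower_neighbors_not_le:
  fixes \<alpha> \<beta> \<gamma> \<delta> :: "'a::{finite, semilattice_inf}"
  assumes md: "meet_distributive TYPE('a)"
    and \<beta>: "\<beta> \<in> lower_neighbors \<alpha>" and \<gamma>: "\<gamma> \<in> lower_neighbors \<alpha>" and \<delta>: "\<delta> \<in> lower_neighbors \<alpha>"
    and "\<beta> \<noteq> \<gamma>" "\<beta> \<noteq> \<delta>"
  shows "\<not> inf \<gamma> \<delta> \<le> \<beta>"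
proof
  assume ass: "inf \<gamma> \<delta> \<le> \<beta>"
  obtain \<mu> where sub: "lower_neighbors \<alpha> \<subseteq> {\<mu>..\<alpha>}" and bl: "boolean_lattice_on {\<mu>..\<alpha>}"
    using meet_distributive_boolean[OF md, of \<alpha>] \<beta> by blast
  have mem: "\<beta> \<in> {\<mu>..\<alpha>}" "\<gamma> \<in> {\<mu>..\<alpha>}" "\<delta> \<in> {\<mu>..\<alpha>}" using sub \<beta> \<gamma> \<delta> by auto
  then have "\<mu> \<le> \<alpha>" by auto
  with bl obtain f :: "'a \<Rightarrow> nat set" where
    f: "\<forall>x\<in>{\<mu>..\<alpha>}. \<forall>y\<in>{\<mu>..\<alpha>}. x \<le> y \<longleftrightarrow> f x \<subseteq> f y"
      "\<forall>x\<in>{\<mu>..\<alpha>}. f x \<subseteq> f \<alpha>"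
      "\<forall>x\<in>{\<mu>..\<alpha>}. \<forall>y\<in>{\<mu>..\<alpha>}. f (inf x y) = f x \<inter> f y"
      "\<forall>\<beta>\<in>lower_neighbors \<alpha>. \<mu> \<le> \<beta> \<longrightarrow> (\<exists>i\<in>f \<alpha>. f \<beta> = f \<alpha> - {i})"
    by (rule boolean_lattice_on_iso)
  note le = f(1)[rule_format] and top = f(2)[rule_format]
    and inf = f(3)[rule_format] and coatom = f(4)[rule_format]
  obtain i where i: "i \<in> f \<alpha>" "f \<beta> = f \<alpha> - {i}" using coatom[OF \<beta>] mem by auto
  obtain j where j: "j \<in> f \<alpha>" "f \<gamma> = f \<alpha> - {j}" using coatom[OF \<gamma>] mem by auto
  obtain k where k: "k \<in> f \<alpha>" "f \<delta> = f \<alpha> - {k}" using coatom[OF \<delta>] mem by auto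
  have "i \<noteq> j"
    using i j le[OF mem(2,1)] lower_neighbors_incomparable[OF \<gamma> \<beta>] \<open>\<beta> \<noteq> \<gamma>\<close> by auto
  moreover have "i \<noteq> k"
    using i k le[OF mem(3,1)] lower_neighbors_incomparable[OF \<delta> \<beta>] \<open>\<beta> \<noteq> \<delta>\<close> by auto
  moreover have "inf \<gamma> \<delta> \<in> {\<mu>..\<alpha>}" using mem by (auto intro: le_infI1)
  then have "f \<gamma> \<inter> f \<delta> \<subseteq> f \<beta>" using le mem ass inf by metis
  ultimately show False using i j k by blast
qed

section \<open>Join-irreducible elements removed on passing to a lower neighbor\<close>

lemma removed_irreducible_unique:
  fixes \<alpha> \<beta> :: "'a::{finite, semilattice_inf}"
  assumes md: "meet_distributive TYPE('a)"
    and "\<beta> \<in> lower_neighbors \<alpha>"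
    and "p \<in> irreducibles_below \<alpha> - irreducibles_below \<beta>"
    and "q \<in> irreducibles_below \<alpha> - irreducibles_below \<beta>"
  shows "p = q"
  using assms(2-)
proof (induction "card {..\<alpha>}" arbitrary: \<alpha> \<beta> p q rule: less_induct)
  case less
  note \<beta> = less.prems(1)
  have mem: "p \<in> join_irreducibles" "p \<le> \<alpha>" "\<not> p \<le> \<beta>" "q \<in> join_irreducibles" "q \<le> \<alpha>" "\<not> q \<le> \<beta>"
    using less.prems by (auto simp: irreducibles_below_def)
  \<comment> \<open>If \<alpha> is join-irreducible, everything strictly below it is below its only
    lower neighbor \<beta>, so only \<alpha> itself can be removed.\<close>
  have triv: "p' = \<alpha>" if "\<alpha> \<in> join_irreducibles" "p' \<le> \<alpha>" "\<not> p' \<le> \<beta>" for p'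
  proof (rule ccontr)
    assume "p' \<noteq> \<alpha>"
    then have "p' < \<alpha>" using that by simp
    then obtain \<gamma> where "\<gamma> \<in> lower_neighbors \<alpha>" "p' \<le> \<gamma>" by (rule le_lower_neighbor)
    then show False using that \<beta> by (auto simp: join_irreducibles_def)
  qed
  show "p = q"
  proof (cases "p = \<alpha> \<or> q = \<alpha>")
    case True
    then show ?thesis using triv mem by metis
  next
    case False
    then have "p < \<alpha>" "q < \<alpha>" using mem by auto
    \<comment> \<open>\<gamma> and \<delta> may be equal.\<close>
    then obtain \<gamma> \<delta> where \<gamma>: "\<gamma> \<in> lower_neighbors \<alpha>" "p \<le> \<gamma>" and \<delta>: "\<delta> \<in> lower_neighbors \<alpha>" "q \<le> \<delta>"
      by (meson le_lower_neighbor)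
    have ne: "\<beta> \<noteq> \<gamma>" "\<beta> \<noteq> \<delta>" using mem \<gamma> \<delta> by auto
    have "\<not> irreducibles_below (inf \<gamma> \<delta>) \<subseteq> irreducibles_below \<beta>"
      using inf_lower_neighbors_not_le[OF md \<beta> \<gamma>(1) \<delta>(1) ne]
      by (simp add: irreducibles_below_subset_iff)
    \<comment> \<open>This r links p to q: the induction hypothesis gives p = r inside \<gamma> and
      q = r inside \<delta>.\<close>
    then obtain r where r: "r \<in> join_irreducibles" "r \<le> \<gamma>" "r \<le> \<delta>" "\<not> r \<le> \<beta>"
      by (auto simp: irreducibles_below_def)
    \<comment> \<open>Both s and r are below \<epsilon> but not below \<beta>, so both are removed
      in passing from \<epsilon> to its lower neighbor
      \<open>inf \<beta> \<epsilon>\<close>.\<close>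
    have IH: "s = r" if "\<epsilon> \<in> lower_neighbors \<alpha>" "\<beta> \<noteq> \<epsilon>" "s \<in> join_irreducibles" "s \<le> \<epsilon>" "\<not> s \<le> \<beta>" "r \<le> \<epsilon>" for s \<epsilon>
    proof (rule less.hyps)
      show "card {..\<epsilon>} < card {..\<alpha>}"
        using that(1) by (intro psubset_card_mono) (auto simp: lower_neighbors_def)
      show "inf \<beta> \<epsilon> \<in> lower_neighbors \<epsilon>"
        using md \<beta> that(1,2) by (rule inf_lower_neighbor)
    qed (use that r in \<open>auto simp: irreducibles_below_def\<close>)
    from IH[OF \<gamma>(1) ne(1)] IH[OF \<delta>(1) ne(2)] mem r \<gamma> \<delta> show ?thesis by metis
  qed
qed

text \<open>The image of this set under \<open>Y\<close> is the least face in the part of the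
  complex assigned to the facet of \<alpha>, like the restriction of a facet in a shelling.\<close>

definition removable :: "'a::order \<Rightarrow> 'a set" where
  "removable \<alpha> = (\<Union>\<beta>\<in>lower_neighbors \<alpha>. irreducibles_below \<alpha> - irreducibles_below \<beta>)"

text \<open>Each lower neighbor contributes exactly one element. Different lower neighbors
  contribute different ones, because the removed p determines
  \<open>irreducibles_below \<beta>\<close> as that of \<alpha> without p, and hence
  \<beta>.\<close>

lemma card_removable:
  fixes \<alpha> :: "'a::{finite, semilattice_inf}"
  assumes md: "meet_distributive TYPE('a)"
  shows "card (removable \<alpha>) = card (lower_neighbors \<alpha>)"
proof -
  let ?D = "\<lambda>\<beta>. irreducibles_below \<alpha> - irreducibles_below \<beta>"
  have one: "card (?D \<beta>) = 1" if \<beta>: "\<beta> \<in> lower_neighbors \<alpha>" for \<beta>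
  proof -
    have "\<not> \<alpha> \<le> \<beta>" using \<beta> by (auto simp: lower_neighbors_def)
    then obtain p where "p \<in> ?D \<beta>"
      using irreducibles_below_subset_iff[of \<alpha> \<beta>] by blast
    then have "?D \<beta> = {p}"
      using removed_irreducible_unique[OF md \<beta>] by blast
    then show ?thesis by simp
  qed
  have disj: "?D \<beta> \<inter> ?D \<gamma> = {}"
    if \<beta>: "\<beta> \<in> lower_neighbors \<alpha>" and \<gamma>: "\<gamma> \<in> lower_neighbors \<alpha>" and "\<beta> \<noteq> \<gamma>" for \<beta> \<gamma>
  proof (rule ccontr)
    assume "?D \<beta> \<inter> ?D \<gamma> \<noteq> {}"
    then obtain p where p: "p \<in> ?D \<beta>" "p \<in> ?D \<gamma>" by blast
    then have "?D \<beta> = {p}" "?D \<gamma> = {p}"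
      using removed_irreducible_unique[OF md \<beta>] removed_irreducible_unique[OF md \<gamma>] by blast+
    moreover have "irreducibles_below \<beta> \<subseteq> irreducibles_below \<alpha>"
      using \<beta> by (auto simp: irreducibles_below_subset_iff lower_neighbors_def)
    ultimately have "irreducibles_below \<beta> \<subseteq> irreducibles_below \<gamma>" by blast
    then have "\<beta> \<le> \<gamma>" by (simp add: irreducibles_below_subset_iff)
    then show False using lower_neighbors_incomparable[OF \<beta> \<gamma>] \<open>\<beta> \<noteq> \<gamma>\<close> by blast
  qed
  have "card (removable \<alpha>) = (\<Sum>\<beta>\<in>lower_neighbors \<alpha>. card (?D \<beta>))"
    unfolding removable_def using disj by (intro card_UN_disjoint) auto
  then show ?thesis using one by simp
qed

text \<open>The witness is the least \<beta> whose join-irreducible elements include B. By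
  minimality each lower neighbor of \<beta> loses an element of B, which is the only element lost.
  For any larger \<gamma> with the same properties, a lower neighbor \<delta> above \<beta> would
  lose an element of B, although B lies below \<beta>.\<close>

lemma unique_removable_subset:
  fixes \<alpha> :: "'a::{finite, semilattice_inf}"
  assumes md: "meet_distributive TYPE('a)" and "B \<subseteq> irreducibles_below \<alpha>"
  obtains \<beta> where "\<beta> \<le> \<alpha>" "B \<subseteq> irreducibles_below \<beta>" "removable \<beta> \<subseteq> B"
    "\<And>\<gamma>. B \<subseteq> irreducibles_below \<gamma> \<Longrightarrow> removable \<gamma> \<subseteq> B \<Longrightarrow> \<gamma> = \<beta>"
proof -
  define S where "S = {\<gamma>. B \<subseteq> irreducibles_below \<gamma>}"
  \<comment> \<open>S contains \<alpha>, so this is a meet over a nonempty set.\<close>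
  define \<beta> where "\<beta> = Inf_fin S"
  have le: "\<beta> \<le> \<gamma>" if "B \<subseteq> irreducibles_below \<gamma>" for \<gamma>
    unfolding \<beta>_def using that by (intro Inf_fin.coboundedI) (auto simp: S_def)
  have "p \<le> \<beta>" if "p \<in> B" for p
    unfolding \<beta>_def using assms that
    by (intro Inf_fin.boundedI) (auto simp: S_def irreducibles_below_def)
  then have B: "B \<subseteq> irreducibles_below \<beta>"
    using assms by (auto simp: irreducibles_below_def)
  have sub: "removable \<beta> \<subseteq> B"
  proof
    fix p assume "p \<in> removable \<beta>"
    then obtain \<gamma> where \<gamma>: "\<gamma> \<in> lower_neighbors \<beta>" "p \<in> irreducibles_below \<beta> - irreducibles_below \<gamma>"
      by (auto simp: removable_def)
    have "\<not> B \<subseteq> irreducibles_below \<gamma>"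
      using le \<gamma>(1) by (fastforce simp: lower_neighbors_def)
    then obtain q where "q \<in> B" "q \<in> irreducibles_below \<beta> - irreducibles_below \<gamma>"
      using B by blast
    with removed_irreducible_unique[OF md \<gamma>] show "p \<in> B" by blast
  qed
  have "\<gamma> = \<beta>" if \<gamma>: "B \<subseteq> irreducibles_below \<gamma>" "removable \<gamma> \<subseteq> B" for \<gamma>
  proof (rule ccontr)
    assume "\<gamma> \<noteq> \<beta>"
    then have "\<beta> < \<gamma>" using le[OF \<gamma>(1)] by auto
    then obtain \<delta> where \<delta>: "\<delta> \<in> lower_neighbors \<gamma>" "\<beta> \<le> \<delta>" by (rule le_lower_neighbor)
    have "\<not> irreducibles_below \<gamma> \<subseteq> irreducibles_below \<delta>"
      using \<delta>(1) by (auto simp: irreducibles_below_subset_iff lower_neighbors_def)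
    then obtain p where "p \<in> irreducibles_below \<gamma> - irreducibles_below \<delta>" by blast
    moreover from this have "p \<in> irreducibles_below \<beta>"
      using \<delta>(1) \<gamma>(2) B by (auto simp: removable_def)
    ultimately show False
      using \<delta>(2) irreducibles_below_subset_iff[of \<beta> \<delta>] by blast
  qed
  with le[OF assms(2)] B sub show thesis by (rule that)
qed

section \<open>Partition of the complex into intervals\<close>

lemma removable_subset: "removable \<alpha> \<subseteq> irreducibles_below \<alpha>"
  by (auto simp: removable_def)

lemma Y_image_subset_dual_facet_iff:
  "Y ` B \<subseteq> dual_facet \<alpha> \<longleftrightarrow> B \<subseteq> irreducibles_below \<alpha>"
  by (auto simp: dual_facet_def)

lemma card_dual_facet:
  "card (dual_facet (\<alpha> :: 'a::{finite, order})) = card (join_irreducibles :: 'a set)"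
proof -
  have sub: "irreducibles_below \<alpha> \<subseteq> join_irreducibles"
    by (auto simp: irreducibles_below_def)
  have "card (dual_facet \<alpha>) = card (join_irreducibles - irreducibles_below \<alpha>) + card (irreducibles_below \<alpha>)"
    unfolding dual_facet_def by (subst card_Un_disjoint) (auto simp: card_image inj_on_def)
  also have "\<dots> = card (join_irreducibles :: 'a set)"
    using sub card_mono[OF _ sub] by (simp add: card_Diff_subset)
  finally show ?thesis .
qed

lemma finite_dual_facet: "finite (dual_facet (\<alpha> :: 'a::{finite, order}))"
  by (simp add: dual_facet_def)

definition facet_interval :: "'a::order \<Rightarrow> 'a vertex set set" where
  "facet_interval \<alpha> = {F. Y ` removable \<alpha> \<subseteq> F \<and> F \<subseteq> dual_facet \<alpha>}"

lemma alexander_dual_eq_Union: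
  assumes md: "meet_distributive TYPE('a::{finite, semilattice_inf})"
  shows "(alexander_dual :: 'a vertex set set) = (\<Union>\<alpha>. facet_interval \<alpha>)"
proof
  show "(alexander_dual :: 'a vertex set set) \<subseteq> (\<Union>\<alpha>. facet_interval \<alpha>)"
  proof
    fix F :: "'a vertex set" assume "F \<in> alexander_dual"
    then obtain \<alpha> where F: "F \<subseteq> dual_facet \<alpha>" by (auto simp: alexander_dual_def)
    define B where "B = {p. Y p \<in> F}"
    have "B \<subseteq> irreducibles_below \<alpha>" using F by (auto simp: B_def dual_facet_def)
    with md obtain \<beta>
      where \<beta>: "\<beta> \<le> \<alpha>" "B \<subseteq> irreducibles_below \<beta>" "removable \<beta> \<subseteq> B"
      by (rule unique_removable_subset)
    \<comment> \<open>This takes care of the X-vertices: those of F avoid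
      \<open>irreducibles_below \<alpha>\<close>, hence also the smaller set for \<beta>.\<close>
    have "irreducibles_below \<beta> \<subseteq> irreducibles_below \<alpha>"
      using \<beta>(1) by (simp add: irreducibles_below_subset_iff)
    then have "v \<in> dual_facet \<beta>" if "v \<in> F" for v
      using F \<beta>(2) that by (cases v) (auto simp: dual_facet_def B_def)
    then have "F \<subseteq> dual_facet \<beta>" by blast
    moreover have "Y ` removable \<beta> \<subseteq> F" using \<beta>(3) by (auto simp: B_def)
    ultimately show "F \<in> (\<Union>\<alpha>. facet_interval \<alpha>)" by (auto simp: facet_interval_def)
  qed
qed (auto simp: facet_interval_def alexander_dual_def)

text \<open>Lying in the interval of \<gamma> forces both conditions of
  \<open>unique_removable_subset\<close> on the set of Y-vertices of F, and these determine
  \<gamma>.\<close>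

lemma facet_interval_disjoint:
  fixes \<alpha> \<beta> :: "'a::{finite, semilattice_inf}"
  assumes md: "meet_distributive TYPE('a)"
    and "F \<in> facet_interval \<alpha>" "F \<in> facet_interval \<beta>"
  shows "\<alpha> = \<beta>"
proof -
  define B where "B = {p. Y p \<in> F}"
  have *: "B \<subseteq> irreducibles_below \<gamma> \<and> removable \<gamma> \<subseteq> B" if "F \<in> facet_interval \<gamma>" for \<gamma>
    using that by (auto simp: facet_interval_def dual_facet_def B_def)
  with assms have "B \<subseteq> irreducibles_below \<alpha>" by blast
  from unique_removable_subset[OF md this] * assms(2,3) show ?thesis by metis
qed

section \<open>Computation of the h-polynomial\<close>

lemma sum_boolean_interval:
  fixes x :: "'b::comm_ring_1"
  assumes "finite T" "S \<subseteq> T"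
  shows "(\<Sum>F | S \<subseteq> F \<and> F \<subseteq> T. x ^ card F * (1 - x) ^ (card T - card F)) = x ^ card S"
proof -
  have fin: "finite S" using assms by (rule rev_finite_subset)
  \<comment> \<open>Writing F as the disjoint union of S and G splits off the factor
    \<open>x ^ card S\<close>.\<close>
  have "(\<Sum>F | S \<subseteq> F \<and> F \<subseteq> T. x ^ card F * (1 - x) ^ (card T - card F))
      = (\<Sum>G\<in>Pow (T - S). x ^ card S * (x ^ card G * (1 - x) ^ card (T - S - G)))"
  proof (rule sum.reindex_bij_witness[where i = "\<lambda>G. S \<union> G" and j = "\<lambda>F. F - S"])
    fix F assume F: "F \<in> {F. S \<subseteq> F \<and> F \<subseteq> T}"
    then have finF: "finite F" using assms finite_subset by blast
    then have c: "card F = card S + card (F - S)"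
      using F fin card_mono[OF finF] by (simp add: card_Diff_subset)
    have "T - S - (F - S) = T - F" using F by auto
    then have "card (T - S - (F - S)) = card T - card F"
      using F finF by (simp add: card_Diff_subset)
    then show "x ^ card S * (x ^ card (F - S) * (1 - x) ^ card (T - S - (F - S)))
        = x ^ card F * (1 - x) ^ (card T - card F)"
      by (simp add: c power_add mult.assoc)
  qed (use assms in auto)
  \<comment> \<open>The sum over G expands a product of factors x + (1 - x): x is chosen on G and 1
    - x off G. Every factor is 1.\<close>
  also have "\<dots> = x ^ card S * (\<Prod>_\<in>T - S. x + (1 - x))"
    using assms(1) by (subst prod_add) (simp_all add: sum_distrib_left)
  finally show ?thesis by simp
qed

text \<open>Grouping faces by cardinality gives the defining sum; finiteness makes
  \<open>complex_rank\<close> a bound on all cardinalities, so no face is missed. As a sum over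
  faces it can be split along the partition.\<close>

lemma h_polynomial_eq_sum_faces:
  fixes \<Delta> :: "'v set set"
  assumes "finite \<Delta>"
  shows "h_polynomial \<Delta> = (\<Sum>F\<in>\<Delta>. monom 1 1 ^ card F * (1 - monom 1 1) ^ (complex_rank \<Delta> - card F))"
proof -
  let ?d = "complex_rank \<Delta>"
  let ?g = "\<lambda>i. monom 1 1 ^ i * (1 - monom 1 1) ^ (?d - i) :: int poly"
  have "(\<Sum>F\<in>\<Delta>. ?g (card F)) = (\<Sum>i\<in>{0..?d}. \<Sum>F | F \<in> \<Delta> \<and> card F = i. ?g (card F))"
    using assms by (intro sum.group[symmetric]) (auto simp: complex_rank_def)
  also have "\<dots> = (\<Sum>i = 0..?d. of_nat (face_count \<Delta> i) * ?g i)"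
    by (intro sum.cong) (auto simp: face_count_def)
  finally show ?thesis
    by (simp add: h_polynomial_def monom_power mult.assoc)
qed

lemma complex_rank_alexander_dual:
  "complex_rank (alexander_dual :: 'a vertex set set) = card (join_irreducibles :: 'a::{finite, semilattice_inf} set)"
  unfolding complex_rank_def
proof (rule Max_eqI)
  have "finite (alexander_dual :: 'a vertex set set)"
    by (rule finite_subset[of _ "\<Union>\<alpha>. Pow (dual_facet \<alpha>)"])
      (auto simp: alexander_dual_def finite_dual_facet)
  then show "finite (card ` (alexander_dual :: 'a vertex set set))" by simp
next
  fix k assume "k \<in> card ` (alexander_dual :: 'a vertex set set)"
  then obtain F and \<alpha> :: 'a where "k = card F" "F \<subseteq> dual_facet \<alpha>"
    by (auto simp: alexander_dual_def)
  then show "k \<le> card (join_irreducibles :: 'a set)"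
    using card_mono[OF finite_dual_facet, of F \<alpha>] card_dual_facet[of \<alpha>] by simp
next
  \<comment> \<open>Here \<open>undefined\<close> is just some element: all facets have the same
    cardinality, so any of them attains the maximum.\<close>
  have "dual_facet undefined \<in> (alexander_dual :: 'a vertex set set)"
    by (auto simp: alexander_dual_def)
  then show "card (join_irreducibles :: 'a set) \<in> card ` (alexander_dual :: 'a vertex set set)"
    using card_dual_facet by (metis imageI)
qed

lemma h_polynomial_alexander_dual:
  assumes md: "meet_distributive TYPE('a::{finite, semilattice_inf})"
  shows "h_polynomial (alexander_dual :: 'a vertex set set)
           = (\<Sum>\<alpha>\<in>(UNIV :: 'a set). monom 1 (card (lower_neighbors \<alpha>)))"
proof -
  let ?d = "card (join_irreducibles :: 'a set)"
  let ?g = "\<lambda>F :: 'a vertex set. monom 1 1 ^ card F * (1 - monom 1 1) ^ (?d - card F) :: int poly"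
  have fin: "finite (facet_interval \<alpha>)" for \<alpha> :: 'a
    by (rule finite_subset[of _ "Pow (dual_facet \<alpha>)"]) (auto simp: facet_interval_def finite_dual_facet)
  have "finite (alexander_dual :: 'a vertex set set)"
    using fin by (simp add: alexander_dual_eq_Union[OF md])
  then have "h_polynomial (alexander_dual :: 'a vertex set set) = (\<Sum>F\<in>alexander_dual. ?g F)"
    by (simp add: h_polynomial_eq_sum_faces complex_rank_alexander_dual)
  also have "\<dots> = (\<Sum>F\<in>(\<Union>\<alpha>::'a. facet_interval \<alpha>). ?g F)"
    by (simp add: alexander_dual_eq_Union[OF md])
  also have "\<dots> = (\<Sum>\<alpha>\<in>UNIV. \<Sum>F\<in>facet_interval \<alpha>. ?g F)"
    using fin facet_interval_disjoint[OF md] by (intro sum.UNION_disjoint) auto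
  also have "\<dots> = (\<Sum>\<alpha>\<in>(UNIV :: 'a set). monom 1 (card (lower_neighbors \<alpha>)))"
  proof (rule sum.cong)
    fix \<alpha> :: 'a
    have "Y ` removable \<alpha> \<subseteq> dual_facet \<alpha>"
      by (simp add: Y_image_subset_dual_facet_iff removable_subset)
    \<comment> \<open>Every facet has \<open>?d\<close> elements, so the exponent
      \<open>?d - card F\<close> is the codimension of F in the facet of \<alpha>, as the interval
      sum requires.\<close>
    from sum_boolean_interval[OF finite_dual_facet this, of "monom 1 1 :: int poly"]
    show "(\<Sum>F\<in>facet_interval \<alpha>. ?g F) = monom 1 (card (lower_neighbors \<alpha>))"
      by (simp add: facet_interval_def card_dual_facet card_image inj_on_def
          card_removable[OF md] monom_power)
  qed simp
  finally show ?thesis .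
qed

theorem proposition1p2:
  fixes i :: nat
  assumes "meet_distributive TYPE('a::{finite, semilattice_inf})"
  shows "h_vector (alexander_dual :: 'a vertex set set) i
           = int (card {\<alpha>::'a. card (lower_neighbors \<alpha>) = i})"
proof -
  have "h_vector (alexander_dual :: 'a vertex set set) i
      = (\<Sum>\<alpha>\<in>(UNIV :: 'a set). if card (lower_neighbors \<alpha>) = i then 1 else 0)"
    by (simp add: h_vector_def h_polynomial_alexander_dual[OF assms] coeff_sum)
  also have "\<dots> = int (card {\<alpha>::'a. card (lower_neighbors \<alpha>) = i})"
    by (simp flip: sum.inter_filter)
  finally show ?thesis .
qed

end
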